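(* Let $\mathcal G=(G,\mathfrak g)$ be a $\star$-reduced Lie supergroup. Let $\mathfrak h_{\bar 0}$ be a Cartan subalgebra of $\mathfrak g_{\bar 0}$ which is compactly embedded in $\mathfrak g$, let $\Delta$ be the root system associated to $\mathfrak h_{\bar 0}$, and let $\mu\in\mathrm{Int}(\mathrm{Cone}(\mathcal G)^\star)\cap\mathbf p^*(\mathfrak h_{\bar 0}^* )$. Then for every nonzero $\alpha\in\Delta$ the Hermitian form $$\langle\cdot,\cdot\rangle_\alpha:\mathfrak g_{\bar 1}^{\mathbb C,\alpha}\times\mathfrak g_{\bar 1}^{\mathbb C,\alpha}\to\mathbb C,\qquad \langle X,Y\rangle_\alpha=\mu([X,\overline Y]),$$ is positive definite.
   Context: All Lie superalgebras $\mathfrak g=\mathfrak g_{\bar 0}\oplus\mathfrak g_{\bar 1}$ are finite dimensional over $\mathbb R$. Lie supergroup: a Harish-Chandra pair $\mathcal G=(G,\mathfrak g)$, i.e. $G$ is a Lie group, $\mathfrak g$ a Lie superalgebra, $\mathfrak g_{\bar 0}$ is the Lie algebra of $G$, $G$ acts smoothly on $\mathfrak g$ by automorphisms (action denoted $\mathrm{Ad}$), and the differential of this action is the adjoint action of $\mathfrak g_{\bar 0}$ on $\mathfrak g$. Unitary representation of $(G,\mathfrak g)$: a triple $(\pi,\rho^\pi,\mathscr H)$ where $\mathscr H=\mathscr H_{\bar 0}\oplus\mathscr H_{\bar 1}$ is a separable complex Hilbert space with $\mathscr H_{\bar 0}\perp\mathscr H_{\bar 1}$ closed subspaces; $\pi$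 is a unitary representation of $G$ on $\mathscr H$ by grading-preserving operators; and, with $\mathscr H^\infty$ the space of smooth vectors of $\pi$, $\rho^\pi:\mathfrak g\to\mathrm{End}_{\mathbb C}(\mathscr H^\infty)$ is an $\mathbb R$-linear $\mathbb Z_2$-graded map such that: $\rho^\pi(X)=\mathsf d\pi(X)$ for $X\in\mathfrak g_{\bar 0}$; $\rho^\pi(X)\rho^\pi(Y)+\rho^\pi(Y)\rho^\pi(X)=-i\rho^\pi([X,Y])$ for $X,Y\in\mathfrak g_{\bar 1}$; $\rho^\pi(X)$ is symmetric for $X\in\mathfrak g_{\bar 1}$; and $\rho^\pi(\mathrm{Ad}(g)X)=\pi(g)\rho^\pi(X)\pi(g)^{-1}$ for $g\in G$, $X\in\mathfrak g$. $\mathcal G$ is $\star$-reduced if for every nonzero $X\in\mathfrak g$ there is a unitary representation $(\pi,\rho^\pi,\mathscr H)$ of $\mathcal G$ with $\rho^\pi(X)\neq 0$. $\mathrm{Cone}(\mathcal G)$ is the closed convex cone in $\mathfrak g_{\bar 0}$, invariant under the group generated by $e^{\mathrm{ad}(\mathfrak g_{\bar 0})}$, that is generated by the elements $[X,X]$, $X\in\mathfrak g_{\bar 1}$. For a cone $C$ in a vector space $V$, $C^\star=\{\lambda\in V^*:\lambda(x)\ge 0\ \forall x\in C\}$; $\mathrm{Int}$ denotes interior. A Lie subalgebra $\mathfrak h_{\bar 0}\subseteq\mathfrak g_{\bar 0}$ is compactly embedded in $\mathfrak g$ if the closure in $\mathrm{Aut}(\mathfrak g)$ of the subgroup generated by $e^{\mathrm{ad}(\mathfrak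 h_{\bar 0})}$ is compact. If $\mathfrak h_{\bar 0}$ is a Cartan subalgebra of $\mathfrak g_{\bar 0}$ compactly embedded in $\mathfrak g$, then it is abelian, $\mathfrak g_{\bar 0}=\mathfrak h_{\bar 0}\oplus[\mathfrak h_{\bar 0},\mathfrak g_{\bar 0}]$, and $\mathfrak g^{\mathbb C}=\mathfrak g\otimes_{\mathbb R}\mathbb C$ is the direct sum of the spaces $\mathfrak g^{\mathbb C,\alpha}=\{X\in\mathfrak g^{\mathbb C}: [H,X]=i\alpha(H)X\ \forall H\in\mathfrak h_{\bar 0}\}$ over $\alpha\in\Delta=\{\alpha\in\mathfrak h_{\bar 0}^*:\mathfrak g^{\mathbb C,\alpha}\ne\{0\}\}$. Write $\mathfrak g_{\bar 1}^{\mathbb C,\alpha}=\mathfrak g^{\mathbb C,\alpha}\cap\mathfrak g_{\bar 1}^{\mathbb C}$. Let $\mathbf p:\mathfrak g_{\bar 0}\to\mathfrak h_{\bar 0}$ be the projection along $[\mathfrak h_{\bar 0},\mathfrak g_{\bar 0}]$ and $\mathbf p^*(\nu)=\nu\circ\mathbf p$. The bar denotes complex conjugation of $\mathfrak g^{\mathbb C}$ with respect to $\mathfrak g$, and $\mu$ is extended $\mathbb C$-linearly to $\mathfrak g_{\bar 0}^{\mathbb C}$. *)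

theory Defs
  imports "HOL-Analysis.Analysis" "HOL-Library.Z2"
begin

section \<open>The separable complex Hilbert space \<open>\<ell>\<^sup>2(\<nat>)\<close>\<close>

text \<open>
  Every separable complex Hilbert space is unitarily isomorphic to a closed complex subspace of
  this space, and every closed complex subspace of it is a separable Hilbert space. This lets us
  quantify over all separable Hilbert spaces inside a formula.
\<close>

typedef ell2 = "{x :: nat \<Rightarrow> complex. summable (\<lambda>n. (cmod (x n))\<^sup>2)}"
  morphisms coord Abs_ell2
  by (rule exI[of _ "\<lambda>_. 0"]) simp

lemma summable_coord: "summable (\<lambda>n. (cmod (coord x n))\<^sup>2)"
  using coord[of x] by simp

lemma coord_Abs: "summable (\<lambda>n. (cmod (x n))\<^sup>2) \<Longrightarrow> coord (Abs_ell2 x) = x"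
  by (simp add: Abs_ell2_inverse)

lemma ell2_eqI: "(\<And>n. coord x n = coord y n) \<Longrightarrow> x = y"
  by (metis coord_inject ext)

lemma cmod_prod_le: "cmod (a * cnj b) \<le> (cmod a)\<^sup>2 + (cmod b)\<^sup>2"
proof -
  have "2 * (cmod a * cmod b) \<le> (cmod a)\<^sup>2 + (cmod b)\<^sup>2"
    using zero_le_power2[of "cmod a - cmod b"] by (simp add: power2_diff)
  moreover have "0 \<le> cmod a * cmod b" by simp
  ultimately have "cmod a * cmod b \<le> (cmod a)\<^sup>2 + (cmod b)\<^sup>2" by linarith
  then show ?thesis by (simp add: norm_mult)
qed

lemma summable_coord_prod: "summable (\<lambda>n. coord x n * cnj (coord y n))"
  by (rule summable_comparison_test[OF _ summable_add[OF summable_coord[of x] summable_coord[of y]]])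
     (auto intro!: exI[of _ 0] cmod_prod_le)

lemma summable_sq_add:
  assumes "summable (\<lambda>n. (cmod (x n))\<^sup>2)" "summable (\<lambda>n. (cmod (y n))\<^sup>2)"
  shows "summable (\<lambda>n. (cmod (x n + y n))\<^sup>2)"
proof (rule summable_comparison_test)
  show "summable (\<lambda>n. 2 * ((cmod (x n))\<^sup>2 + (cmod (y n))\<^sup>2))"
    by (intro summable_mult summable_add assms)
  have "(cmod (a + b))\<^sup>2 \<le> 2 * ((cmod a)\<^sup>2 + (cmod b)\<^sup>2)" for a b :: complex
  proof -
    have "(cmod (a + b))\<^sup>2 \<le> (cmod a + cmod b)\<^sup>2"
      by (intro power_mono norm_triangle_ineq) simp
    also have "\<dots> \<le> 2 * ((cmod a)\<^sup>2 + (cmod b)\<^sup>2)"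
      using zero_le_power2[of "cmod a - cmod b"] by (simp add: power2_eq_square algebra_simps)
    finally show ?thesis .
  qed
  then show "\<exists>N. \<forall>n\<ge>N. norm ((cmod (x n + y n))\<^sup>2) \<le> 2 * ((cmod (x n))\<^sup>2 + (cmod (y n))\<^sup>2)"
    by simp
qed

lemma summable_sq_scale:
  "summable (\<lambda>n. (cmod (x n))\<^sup>2) \<Longrightarrow> summable (\<lambda>n. (cmod (c * x n))\<^sup>2)"
  by (simp add: norm_mult power_mult_distrib summable_mult)

definition scaleC :: "complex \<Rightarrow> ell2 \<Rightarrow> ell2" where
  "scaleC c x = Abs_ell2 (\<lambda>n. c * coord x n)"

definition cinner :: "ell2 \<Rightarrow> ell2 \<Rightarrow> complex" where
  "cinner x y = (\<Sum>n. coord x n * cnj (coord y n))"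

instantiation ell2 :: real_inner
begin

definition "0 = Abs_ell2 (\<lambda>_. 0)"
definition "x + y = Abs_ell2 (\<lambda>n. coord x n + coord y n)"
definition "- x = scaleC (-1) x"
definition "x - y = x + - (y :: ell2)"
definition "r *\<^sub>R x = scaleC (complex_of_real r) x"
definition "inner x y = Re (cinner x y)"
definition "norm x = sqrt (inner x (x :: ell2))"
definition "dist x y = norm (x - y :: ell2)"
definition "sgn x = inverse (norm x) *\<^sub>R (x :: ell2)"
definition "uniformity = (INF e\<in>{0<..}. principal {(x, y :: ell2). dist x y < e})"
definition "open U \<longleftrightarrow> (\<forall>x\<in>U. \<forall>\<^sub>F (x', y) in uniformity. x' = x \<longrightarrow> y \<in> (U :: ell2 set))"

lemma coord_zero [simp]: "coord 0 n = 0"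
  by (simp add: zero_ell2_def coord_Abs)

lemma coord_add [simp]: "coord (x + y) n = coord x n + coord y n"
  by (simp add: plus_ell2_def coord_Abs summable_sq_add summable_coord)

lemma coord_scaleC [simp]: "coord (scaleC c x) n = c * coord x n"
  by (simp add: scaleC_def coord_Abs summable_sq_scale summable_coord)

lemma coord_uminus [simp]: "coord (- x) n = - coord x n"
  by (simp add: uminus_ell2_def)

lemma coord_diff [simp]: "coord (x - y) n = coord x n - coord y n"
  by (simp add: minus_ell2_def)

lemma coord_scaleR [simp]: "coord (r *\<^sub>R x) n = complex_of_real r * coord x n"
  by (simp add: scaleR_ell2_def)

lemma inner_ell2_alt: "inner x y = (\<Sum>n. Re (coord x n * cnj (coord y n)))"
  unfolding inner_ell2_def cinner_def by (rule Re_suminf[OF summable_coord_prod])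

lemma summable_inner_ell2: "summable (\<lambda>n. Re (coord x n * cnj (coord y n)))"
  by (rule summable_Re[OF summable_coord_prod])

lemma Re_self: "Re (z * cnj z) = (cmod z)\<^sup>2"
  by (metis Re_complex_of_real complex_norm_square)

lemma inner_self_ell2: "inner x x = (\<Sum>n. (cmod (coord x n))\<^sup>2)"
  by (simp only: inner_ell2_alt Re_self)

instance
proof
  fix x y z :: ell2 and r s :: real and U :: "ell2 set"
  show "x + y + z = x + (y + z)" "x + y = y + x" "0 + x = x" "- x + x = 0" "x - y = x + - y"
    by (auto intro!: ell2_eqI)
  show "r *\<^sub>R (x + y) = r *\<^sub>R x + r *\<^sub>R y" "(r + s) *\<^sub>R x = r *\<^sub>R x + s *\<^sub>R x"
    "r *\<^sub>R s *\<^sub>R x = (r * s) *\<^sub>R x" "1 *\<^sub>R x = x"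
    by (auto intro!: ell2_eqI simp: algebra_simps)
  show "dist x y = norm (x - y)" "sgn x = inverse (norm x) *\<^sub>R x" "norm x = sqrt (inner x x)"
    "uniformity = (INF e\<in>{0<..}. principal {(x, y :: ell2). dist x y < e})"
    "open U \<longleftrightarrow> (\<forall>x\<in>U. \<forall>\<^sub>F (x', y) in uniformity. x' = x \<longrightarrow> y \<in> U)"
    by (fact dist_ell2_def sgn_ell2_def norm_ell2_def uniformity_ell2_def open_ell2_def)+
  show "inner x y = inner y x"
    by (simp add: inner_ell2_alt mult.commute)
  show "inner (x + y) z = inner x z + inner y z"
    unfolding inner_ell2_alt
    by (subst suminf_add[OF summable_inner_ell2 summable_inner_ell2]) (simp add: algebra_simps)
  show "inner (r *\<^sub>R x) y = r * inner x y"
    unfolding inner_ell2_alt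
    by (subst suminf_mult[OF summable_inner_ell2, symmetric]) (simp add: algebra_simps)
  show "0 \<le> inner x x"
    unfolding inner_self_ell2 by (intro suminf_nonneg summable_coord) simp
  show "inner x x = 0 \<longleftrightarrow> x = 0"
    unfolding inner_self_ell2 by (subst suminf_eq_zero_iff[OF summable_coord]) (auto intro: ell2_eqI)
qed

end

lemma norm_ell2: "norm x = sqrt (\<Sum>n. (cmod (coord x n))\<^sup>2)"
  by (simp add: norm_ell2_def inner_self_ell2)

lemma sum_coord_le_norm: "(\<Sum>n<k. (cmod (coord x n))\<^sup>2) \<le> (norm x)\<^sup>2"
  unfolding norm_ell2
  by (simp add: suminf_nonneg summable_coord) (intro sum_le_suminf summable_coord, auto)

lemma cmod_coord_le_norm: "cmod (coord x n) \<le> norm x"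
proof -
  have "(cmod (coord x n))\<^sup>2 \<le> (\<Sum>m<Suc n. (cmod (coord x m))\<^sup>2)"
    by (simp add: sum_nonneg)
  also have "\<dots> \<le> (norm x)\<^sup>2" by (rule sum_coord_le_norm)
  finally show ?thesis by (simp add: power2_le_iff_abs_le)
qed

instance ell2 :: complete_space
proof
  fix X :: "nat \<Rightarrow> ell2"
  assume X: "Cauchy X"
  have "Cauchy (\<lambda>k. coord (X k) n)" for n
  proof (rule metric_CauchyI)
    fix e :: real assume "e > 0"
    with X obtain M where "\<forall>m\<ge>M. \<forall>k\<ge>M. dist (X m) (X k) < e" by (meson metric_CauchyD)
    then show "\<exists>M. \<forall>m\<ge>M. \<forall>k\<ge>M. dist (coord (X m) n) (coord (X k) n) < e"
      by (metis cmod_coord_le_norm coord_diff dist_norm order_le_less_trans)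
  qed
  then have "\<forall>n. \<exists>l. (\<lambda>k. coord (X k) n) \<longlonglongrightarrow> l"
    by (simp add: Cauchy_convergent_iff convergent_def)
  then obtain y where y: "\<And>n. (\<lambda>k. coord (X k) n) \<longlonglongrightarrow> y n" by metis
  have bound: "\<exists>M. \<forall>m\<ge>M. summable (\<lambda>n. (cmod (coord (X m) n - y n))\<^sup>2)
      \<and> (\<Sum>n. (cmod (coord (X m) n - y n))\<^sup>2) \<le> e\<^sup>2" if e: "e > 0" for e :: real
  proof -
    from X e obtain M where M: "\<And>m k. m \<ge> M \<Longrightarrow> k \<ge> M \<Longrightarrow> dist (X m) (X k) < e"
      by (meson metric_CauchyD)
    have part: "(\<Sum>n<K. (cmod (coord (X m) n - y n))\<^sup>2) \<le> e\<^sup>2" if m: "m \<ge> M" for m K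
    proof (rule LIMSEQ_le_const2)
      show "(\<lambda>k. \<Sum>n<K. (cmod (coord (X m) n - coord (X k) n))\<^sup>2)
          \<longlonglongrightarrow> (\<Sum>n<K. (cmod (coord (X m) n - y n))\<^sup>2)"
        by (intro tendsto_intros y)
      have "(\<Sum>n<K. (cmod (coord (X m) n - coord (X k) n))\<^sup>2) \<le> e\<^sup>2" if "k \<ge> M" for k
      proof -
        have "(\<Sum>n<K. (cmod (coord (X m) n - coord (X k) n))\<^sup>2) \<le> (norm (X m - X k))\<^sup>2"
          using sum_coord_le_norm[of "X m - X k" K] by simp
        also have "\<dots> \<le> e\<^sup>2"
          using M[OF m that] by (intro power_mono) (auto simp: dist_norm)
        finally show ?thesis .
      qed
      then show "\<exists>N. \<forall>k\<ge>N. (\<Sum>n<K. (cmod (coord (X m) n - coord (X k) n))\<^sup>2) \<le> e\<^sup>2"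
        by blast
    qed
    have "summable (\<lambda>n. (cmod (coord (X m) n - y n))\<^sup>2)" if "m \<ge> M" for m
    proof (rule bounded_imp_summable[of _ "e\<^sup>2"])
      show "(\<Sum>k\<le>K. (cmod (coord (X m) k - y k))\<^sup>2) \<le> e\<^sup>2" for K
        using part[OF that, of "Suc K"] by (simp only: lessThan_Suc_atMost)
    qed simp
    moreover have "(\<Sum>n. (cmod (coord (X m) n - y n))\<^sup>2) \<le> e\<^sup>2" if "m \<ge> M" for m
      by (rule suminf_le_const[OF calculation[OF that] part[OF that]])
    ultimately show ?thesis by blast
  qed
  obtain m where m: "summable (\<lambda>n. (cmod (coord (X m) n - y n))\<^sup>2)"
    using bound[of 1] by auto
  have "summable (\<lambda>n. (cmod (coord (X m) n + (-1) * (coord (X m) n - y n)))\<^sup>2)"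
    by (intro summable_sq_add summable_sq_scale summable_coord m)
  then have y2: "coord (Abs_ell2 y) = y"
    by (intro coord_Abs) simp
  have "X \<longlonglongrightarrow> Abs_ell2 y"
  proof (rule metric_LIMSEQ_I)
    fix e :: real assume e: "e > 0"
    then obtain M where
      M: "\<forall>m\<ge>M. (\<Sum>n. (cmod (coord (X m) n - y n))\<^sup>2) \<le> (e / 2)\<^sup>2"
      using bound[of "e / 2"] by auto
    have "dist (X m) (Abs_ell2 y) < e" if "m \<ge> M" for m
    proof -
      have "dist (X m) (Abs_ell2 y) \<le> sqrt ((e / 2)\<^sup>2)"
        unfolding dist_norm norm_ell2 using M that y2 by (intro real_sqrt_le_mono) simp
      then show ?thesis using e by simp
    qed
    then show "\<exists>M. \<forall>m\<ge>M. dist (X m) (Abs_ell2 y) < e" by blast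
  qed
  then show "convergent X" by (auto simp: convergent_def)
qed

definition complex_subspace :: "ell2 set \<Rightarrow> bool" where
  "complex_subspace S \<longleftrightarrow>
     0 \<in> S \<and> (\<forall>v\<in>S. \<forall>w\<in>S. v + w \<in> S) \<and> (\<forall>c. \<forall>v\<in>S. scaleC c v \<in> S)"

definition complex_linear_on :: "ell2 set \<Rightarrow> (ell2 \<Rightarrow> ell2) \<Rightarrow> bool" where
  "complex_linear_on S T \<longleftrightarrow>
     (\<forall>v\<in>S. \<forall>w\<in>S. T (v + w) = T v + T w) \<and> (\<forall>c. \<forall>v\<in>S. T (scaleC c v) = scaleC c (T v))"


section \<open>Smooth maps and Lie groups\<close>

text \<open>
  Here \<open>E\<close> is a linear subspace of a Euclidean space and \<open>S\<close> is relatively open in \<open>E\<close>. The values of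
  the derivative are then determined exactly on \<open>E\<close>, and for finite-dimensional \<open>E\<close> the map
  \<open>x \<mapsto> f' x\<close> is \<open>C\<^sup>k\<close> iff \<open>x \<mapsto> f' x v\<close> is \<open>C\<^sup>k\<close> for every \<open>v \<in> E\<close>.
\<close>

primrec Ck_on :: "nat \<Rightarrow> 'a set \<Rightarrow> 'a set \<Rightarrow> ('a::real_normed_vector \<Rightarrow> 'b::real_normed_vector) \<Rightarrow> bool"
where
  "Ck_on 0 E S f \<longleftrightarrow> continuous_on S f"
| "Ck_on (Suc k) E S f \<longleftrightarrow>
     (\<exists>f'. (\<forall>x\<in>S. (f has_derivative f' x) (at x within S)) \<and>
           (\<forall>v\<in>E. Ck_on k E S (\<lambda>x. f' x v)))"

definition smooth_on :: "'a set \<Rightarrow> 'a set \<Rightarrow> ('a::real_normed_vector \<Rightarrow> 'b::real_normed_vector) \<Rightarrow> bool" where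
  "smooth_on E S f \<longleftrightarrow> (\<forall>k. Ck_on k E S f)"

type_synonym ('m, 'e) atlas = "('m set \<times> ('m \<Rightarrow> 'e)) set"

definition smooth_atlas :: "'e::euclidean_space set \<Rightarrow> ('m::t2_space, 'e) atlas \<Rightarrow> bool" where
  "smooth_atlas E A \<longleftrightarrow> subspace E \<and> (\<Union>(U, \<phi>)\<in>A. U) = UNIV \<and>
     (\<forall>(U, \<phi>)\<in>A. open U \<and> openin (top_of_set E) (\<phi> ` U) \<and>
                  homeomorphism U (\<phi> ` U) \<phi> (inv_into U \<phi>)) \<and>
     (\<forall>(U, \<phi>)\<in>A. \<forall>(V, \<psi>)\<in>A. smooth_on E (\<phi> ` (U \<inter> V)) (\<psi> \<circ> inv_into U \<phi>))"

definition smooth_fun ::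
  "'e::euclidean_space set \<Rightarrow> ('m, 'e) atlas \<Rightarrow> ('m \<Rightarrow> 'b::real_normed_vector) \<Rightarrow> bool" where
  "smooth_fun E A f \<longleftrightarrow> (\<forall>(U, \<phi>)\<in>A. smooth_on E (\<phi> ` U) (f \<circ> inv_into U \<phi>))"

text \<open>
  The library class of (not necessarily commutative) topological groups is additive: the product
  of group elements is written \<open>a + b\<close>, the inverse \<open>- a\<close> and the neutral element \<open>0\<close>.
  Groups are not assumed to be second countable.
\<close>

definition lie_group ::
  "'e::euclidean_space set \<Rightarrow> ('m::{t2_space,topological_group_add}, 'e) atlas \<Rightarrow> bool" where
  "lie_group E A \<longleftrightarrow> smooth_atlas E A \<and>
     (\<forall>(U, \<phi>)\<in>A. \<forall>(V, \<psi>)\<in>A. \<forall>(W, \<theta>)\<in>A.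
        smooth_on (E \<times> E) {(\<phi> a, \<psi> b) | a b. a \<in> U \<and> b \<in> V \<and> a + b \<in> W}
          (\<lambda>(x, y). \<theta> (inv_into U \<phi> x + inv_into V \<psi> y))) \<and>
     (\<forall>(U, \<phi>)\<in>A. \<forall>(V, \<psi>)\<in>A.
        smooth_on E {\<phi> a | a. a \<in> U \<and> - a \<in> V} (\<lambda>x. \<psi> (- inv_into U \<phi> x)))"

text \<open>
  Left-invariant vector fields, as derivations of the algebra of smooth functions. A derivation
  is extended by 0 to non-smooth functions, so that equality of functions is equality of derivations.
\<close>

definition left_invariant_fields ::
  "'e::euclidean_space set \<Rightarrow> ('m::{t2_space,topological_group_add}, 'e) atlas
     \<Rightarrow> (('m \<Rightarrow> real) \<Rightarrow> 'm \<Rightarrow> real) set" where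
  "left_invariant_fields E A =
     {D. (\<forall>f. smooth_fun E A f \<longrightarrow> smooth_fun E A (D f)) \<and>
         (\<forall>f. \<not> smooth_fun E A f \<longrightarrow> D f = (\<lambda>_. 0)) \<and>
         (\<forall>f h. smooth_fun E A f \<longrightarrow> smooth_fun E A h \<longrightarrow>
            D (\<lambda>a. f a + h a) = (\<lambda>a. D f a + D h a) \<and>
            D (\<lambda>a. f a * h a) = (\<lambda>a. D f a * h a + f a * D h a)) \<and>
         (\<forall>f c. smooth_fun E A f \<longrightarrow> D (\<lambda>a. c * f a) = (\<lambda>a. c * D f a)) \<and>
         (\<forall>f b. smooth_fun E A f \<longrightarrow> D (\<lambda>a. f (b + a)) = (\<lambda>a. D f (b + a)))}"


section \<open>Lie superalgebras\<close>

text \<open>The grading is indexed by \<open>\<int>/2\<close>, the type \<open>bit\<close>; \<open>part 0\<close> is even and \<open>part 1\<close> is odd.\<close>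

record 'g superalgebra =
  part :: "bit \<Rightarrow> 'g set"
  brac :: "'g \<Rightarrow> 'g \<Rightarrow> 'g"

definition koszul :: "bit \<Rightarrow> bit \<Rightarrow> real" where
  "koszul i j = (if i = 1 \<and> j = 1 then - 1 else 1)"

definition lie_superalgebra :: "('g::euclidean_space, 'z) superalgebra_scheme \<Rightarrow> bool" where
  "lie_superalgebra \<gg> \<longleftrightarrow>
     (\<forall>i. subspace (part \<gg> i)) \<and>
     part \<gg> 0 \<inter> part \<gg> 1 = {0} \<and> (\<forall>Z. \<exists>X\<in>part \<gg> 0. \<exists>Y\<in>part \<gg> 1. Z = X + Y) \<and>
     bilinear (brac \<gg>) \<and>
     (\<forall>i j. \<forall>X\<in>part \<gg> i. \<forall>Y\<in>part \<gg> j.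
        brac \<gg> X Y \<in> part \<gg> (i + j) \<and> brac \<gg> X Y = - (koszul i j *\<^sub>R brac \<gg> Y X)) \<and>
     (\<forall>i j. \<forall>X\<in>part \<gg> i. \<forall>Y\<in>part \<gg> j. \<forall>Z.
        brac \<gg> X (brac \<gg> Y Z) = brac \<gg> (brac \<gg> X Y) Z + koszul i j *\<^sub>R brac \<gg> Y (brac \<gg> X Z))"

definition superalgebra_aut :: "('g::euclidean_space, 'z) superalgebra_scheme \<Rightarrow> ('g \<Rightarrow> 'g) set" where
  "superalgebra_aut \<gg> =
     {f. linear f \<and> bij f \<and> (\<forall>i. f ` part \<gg> i = part \<gg> i) \<and>
         (\<forall>X Y. f (brac \<gg> X Y) = brac \<gg> (f X) (f Y))}"

definition exp_ad :: "('g::euclidean_space, 'z) superalgebra_scheme \<Rightarrow> 'g \<Rightarrow> 'g \<Rightarrow> 'g" where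
  "exp_ad \<gg> X Y = (\<Sum>n. (brac \<gg> X ^^ n) Y /\<^sub>R fact n)"

inductive_set generated_group :: "('a \<Rightarrow> 'a) set \<Rightarrow> ('a \<Rightarrow> 'a) set" for S where
  one: "id \<in> generated_group S"
| gen: "s \<in> S \<Longrightarrow> f \<in> generated_group S \<Longrightarrow> s \<circ> f \<in> generated_group S"
| inverse: "s \<in> S \<Longrightarrow> f \<in> generated_group S \<Longrightarrow> inv s \<circ> f \<in> generated_group S"

text \<open>
  The topology on maps \<open>'g \<Rightarrow> 'g\<close> is that of pointwise convergence. On linear endomorphisms of a
  finite-dimensional space it is the usual one.
\<close>

definition compactly_embedded :: "('g::euclidean_space, 'z) superalgebra_scheme \<Rightarrow> 'g set \<Rightarrow> bool" where
  "compactly_embedded \<gg> \<hh> \<longleftrightarrow>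
     compact (top_of_set (superalgebra_aut \<gg>) closure_of generated_group (exp_ad \<gg> ` \<hh>))"

definition brac_span :: "('g::euclidean_space, 'z) superalgebra_scheme \<Rightarrow> 'g set \<Rightarrow> 'g set \<Rightarrow> 'g set" where
  "brac_span \<gg> A B = span {brac \<gg> X Y | X Y. X \<in> A \<and> Y \<in> B}"

primrec lower_central :: "('g::euclidean_space, 'z) superalgebra_scheme \<Rightarrow> 'g set \<Rightarrow> nat \<Rightarrow> 'g set" where
  "lower_central \<gg> \<hh> 0 = \<hh>"
| "lower_central \<gg> \<hh> (Suc n) = brac_span \<gg> \<hh> (lower_central \<gg> \<hh> n)"

text \<open>Cartan subalgebras of the even part: nilpotent subalgebras equal to their normalizer.\<close>

definition cartan_subalgebra :: "('g::euclidean_space, 'z) superalgebra_scheme \<Rightarrow> 'g set \<Rightarrow> bool" where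
  "cartan_subalgebra \<gg> \<hh> \<longleftrightarrow>
     subspace \<hh> \<and> \<hh> \<subseteq> part \<gg> 0 \<and> (\<forall>X\<in>\<hh>. \<forall>Y\<in>\<hh>. brac \<gg> X Y \<in> \<hh>) \<and>
     (\<exists>n. lower_central \<gg> \<hh> n = {0}) \<and>
     {X \<in> part \<gg> 0. \<forall>H\<in>\<hh>. brac \<gg> X H \<in> \<hh>} = \<hh>"

text \<open>
  The dual of a subspace \<open>V\<close>: a functional on \<open>V\<close> is represented by its extension by 0 to the
  complement of \<open>V\<close>. The topology of pointwise convergence induces the usual topology of \<open>V\<^sup>*\<close>.
\<close>

definition dual_space :: "'g::euclidean_space set \<Rightarrow> ('g \<Rightarrow> real) set" where
  "dual_space V =
     {l. (\<forall>x\<in>V. \<forall>y\<in>V. l (x + y) = l x + l y) \<and> (\<forall>c. \<forall>x\<in>V. l (c *\<^sub>R x) = c * l x) \<and>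
         (\<forall>x. x \<notin> V \<longrightarrow> l x = 0)}"

definition dual_cone :: "'g::euclidean_space set \<Rightarrow> 'g set \<Rightarrow> ('g \<Rightarrow> real) set" where
  "dual_cone V C = {l \<in> dual_space V. \<forall>x\<in>C. 0 \<le> l x}"

definition super_cone :: "('g::euclidean_space, 'z) superalgebra_scheme \<Rightarrow> 'g set" where
  "super_cone \<gg> =
     (\<lambda>C. C \<subseteq> part \<gg> 0 \<and> closed C \<and> convex_cone C \<and>
          (\<forall>f\<in>generated_group (exp_ad \<gg> ` part \<gg> 0). f ` C \<subseteq> C))
     hull {brac \<gg> X X | X. X \<in> part \<gg> 1}"

text \<open>The projection of the even part onto \<open>\<hh>\<close> along \<open>[\<hh>, \<gg>\<^sub>0]\<close>, and its transpose.\<close>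

definition cartan_proj :: "('g::euclidean_space, 'z) superalgebra_scheme \<Rightarrow> 'g set \<Rightarrow> 'g \<Rightarrow> 'g" where
  "cartan_proj \<gg> \<hh> X = (THE H. H \<in> \<hh> \<and> X - H \<in> brac_span \<gg> \<hh> (part \<gg> 0))"

definition cartan_pullback ::
  "('g::euclidean_space, 'z) superalgebra_scheme \<Rightarrow> 'g set \<Rightarrow> ('g \<Rightarrow> real) \<Rightarrow> 'g \<Rightarrow> real" where
  "cartan_pullback \<gg> \<hh> \<nu> = (\<lambda>X. if X \<in> part \<gg> 0 then \<nu> (cartan_proj \<gg> \<hh> X) else 0)"


section \<open>Complexification and root spaces\<close>

text \<open>A pair \<open>(X, Y)\<close> represents \<open>X + \<i>Y\<close>.\<close>

definition cscale :: "complex \<Rightarrow> 'g::real_vector \<times> 'g \<Rightarrow> 'g \<times> 'g" where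
  "cscale c = (\<lambda>(X, Y). (Re c *\<^sub>R X - Im c *\<^sub>R Y, Re c *\<^sub>R Y + Im c *\<^sub>R X))"

definition conjC :: "'g::real_vector \<times> 'g \<Rightarrow> 'g \<times> 'g" where
  "conjC = (\<lambda>(X, Y). (X, - Y))"

definition bracC :: "('g::euclidean_space, 'z) superalgebra_scheme \<Rightarrow> 'g \<times> 'g \<Rightarrow> 'g \<times> 'g \<Rightarrow> 'g \<times> 'g" where
  "bracC \<gg> = (\<lambda>(X, Y) (X', Y').
     (brac \<gg> X X' - brac \<gg> Y Y', brac \<gg> X Y' + brac \<gg> Y X'))"

definition functionalC :: "('g \<Rightarrow> real) \<Rightarrow> 'g \<times> 'g \<Rightarrow> complex" where
  "functionalC l = (\<lambda>(X, Y). Complex (l X) (l Y))"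

definition root_space ::
  "('g::euclidean_space, 'z) superalgebra_scheme \<Rightarrow> 'g set \<Rightarrow> ('g \<Rightarrow> real) \<Rightarrow> ('g \<times> 'g) set" where
  "root_space \<gg> \<hh> \<alpha> =
     {Z. \<forall>H\<in>\<hh>. bracC \<gg> (H, 0) Z = cscale (\<i> * complex_of_real (\<alpha> H)) Z}"

definition odd_root_space ::
  "('g::euclidean_space, 'z) superalgebra_scheme \<Rightarrow> 'g set \<Rightarrow> ('g \<Rightarrow> real) \<Rightarrow> ('g \<times> 'g) set" where
  "odd_root_space \<gg> \<hh> \<alpha> = root_space \<gg> \<hh> \<alpha> \<inter> (part \<gg> 1 \<times> part \<gg> 1)"

definition roots :: "('g::euclidean_space, 'z) superalgebra_scheme \<Rightarrow> 'g set \<Rightarrow> ('g \<Rightarrow> real) set" where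
  "roots \<gg> \<hh> = {\<alpha> \<in> dual_space \<hh>. root_space \<gg> \<hh> \<alpha> \<noteq> {0}}"

definition hermitian_form_on ::
  "('g::real_vector \<times> 'g) set \<Rightarrow> ('g \<times> 'g \<Rightarrow> 'g \<times> 'g \<Rightarrow> complex) \<Rightarrow> bool" where
  "hermitian_form_on S B \<longleftrightarrow>
     (\<forall>X\<in>S. \<forall>X'\<in>S. \<forall>Y\<in>S. B (X + X') Y = B X Y + B X' Y) \<and>
     (\<forall>c. \<forall>X\<in>S. \<forall>Y\<in>S. B (cscale c X) Y = c * B X Y) \<and>
     (\<forall>X\<in>S. \<forall>Y\<in>S. B Y X = cnj (B X Y))"

definition positive_definite_on ::
  "('g::real_vector \<times> 'g) set \<Rightarrow> ('g \<times> 'g \<Rightarrow> 'g \<times> 'g \<Rightarrow> complex) \<Rightarrow> bool" where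
  "positive_definite_on S B \<longleftrightarrow> (\<forall>X\<in>S. X \<noteq> 0 \<longrightarrow> B X X \<in> \<real> \<and> 0 < Re (B X X))"


section \<open>Lie supergroups and their unitary representations\<close>

text \<open>
  The charts of the group take values in the even part, which serves as the model space.
  The field \<open>lie\<close> is the identification of the even part with the Lie algebra of left-invariant
  vector fields.
\<close>

record ('g, 'm) supergroup = "'g superalgebra" +
  charts :: "('m, 'g) atlas"
  lie :: "'g \<Rightarrow> ('m \<Rightarrow> real) \<Rightarrow> 'm \<Rightarrow> real"
  Ad :: "'m \<Rightarrow> 'g \<Rightarrow> 'g"

text \<open>\<open>\<gamma> t = exp (t X)\<close>\<close>

definition one_parameter_group ::
  "('g::euclidean_space, 'm::{t2_space,topological_group_add}) supergroup \<Rightarrow> 'g \<Rightarrow> (real \<Rightarrow> 'm) \<Rightarrow> bool" where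
  "one_parameter_group \<G> X \<gamma> \<longleftrightarrow>
     (\<forall>s t. \<gamma> (s + t) = \<gamma> s + \<gamma> t) \<and>
     (\<forall>f. smooth_fun (part \<G> 0) (charts \<G>) f \<longrightarrow>
        ((\<lambda>t. f (\<gamma> t)) has_real_derivative lie \<G> X f 0) (at 0))"

definition lie_supergroup ::
  "('g::euclidean_space, 'm::{t2_space,topological_group_add}) supergroup \<Rightarrow> bool" where
  "lie_supergroup \<G> \<longleftrightarrow>
     lie_superalgebra \<G> \<and> lie_group (part \<G> 0) (charts \<G>) \<and>
     \<comment> \<open>\<open>lie\<close> is an isomorphism of Lie algebras\<close>
     bij_betw (lie \<G>) (part \<G> 0) (left_invariant_fields (part \<G> 0) (charts \<G>)) \<and>
     (\<forall>X\<in>part \<G> 0. \<forall>Y\<in>part \<G> 0. \<forall>f. \<forall>c.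
        lie \<G> (X + Y) f = (\<lambda>a. lie \<G> X f a + lie \<G> Y f a) \<and>
        lie \<G> (c *\<^sub>R X) f = (\<lambda>a. c * lie \<G> X f a) \<and>
        lie \<G> (brac \<G> X Y) f = (\<lambda>a. lie \<G> X (lie \<G> Y f) a - lie \<G> Y (lie \<G> X f) a)) \<and>
     \<comment> \<open>\<open>Ad\<close> is a smooth action by automorphisms whose differential is the adjoint action\<close>
     (\<forall>a. Ad \<G> a \<in> superalgebra_aut \<G>) \<and>
     Ad \<G> 0 = id \<and> (\<forall>a b. Ad \<G> (a + b) = Ad \<G> a \<circ> Ad \<G> b) \<and>
     (\<forall>(U, \<phi>)\<in>charts \<G>.
        smooth_on (part \<G> 0 \<times> UNIV) (\<phi> ` U \<times> UNIV) (\<lambda>(x, Y). Ad \<G> (inv_into U \<phi> x) Y)) \<and>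
     (\<forall>X\<in>part \<G> 0. \<forall>\<gamma> Y. one_parameter_group \<G> X \<gamma> \<longrightarrow>
        ((\<lambda>t. Ad \<G> (\<gamma> t) Y) has_vector_derivative brac \<G> X Y) (at 0))"

record ('g, 'm) representation =
  hilb :: "bit \<Rightarrow> ell2 set"
  rep :: "'m \<Rightarrow> ell2 \<Rightarrow> ell2"
  drep :: "'g \<Rightarrow> ell2 \<Rightarrow> ell2"

definition rep_space :: "('g, 'm) representation \<Rightarrow> ell2 set" where
  "rep_space R = {v + w | v w. v \<in> hilb R 0 \<and> w \<in> hilb R 1}"

definition smooth_vectors ::
  "('g::euclidean_space, 'm::{t2_space,topological_group_add}) supergroup
     \<Rightarrow> ('g, 'm) representation \<Rightarrow> ell2 set" where
  "smooth_vectors \<G> R =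
     {v \<in> rep_space R. smooth_fun (part \<G> 0) (charts \<G>) (\<lambda>a. rep R a v)}"

definition graded_hilbert_space :: "('g, 'm) representation \<Rightarrow> bool" where
  "graded_hilbert_space R \<longleftrightarrow>
     (\<forall>j. complex_subspace (hilb R j) \<and> closed (hilb R j)) \<and>
     (\<forall>v\<in>hilb R 0. \<forall>w\<in>hilb R 1. cinner v w = 0)"

text \<open>Surjectivity of the operators \<open>rep R a\<close> follows from the group law.\<close>

definition graded_unitary_group_rep :: "('g, 'm::topological_group_add) representation \<Rightarrow> bool" where
  "graded_unitary_group_rep R \<longleftrightarrow>
     (\<forall>a. complex_linear_on (rep_space R) (rep R a) \<and>
        (\<forall>j. \<forall>v\<in>hilb R j. rep R a v \<in> hilb R j) \<and>
        (\<forall>v\<in>rep_space R. \<forall>w\<in>rep_space R. cinner (rep R a v) (rep R a w) = cinner v w)) \<and>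
     (\<forall>v\<in>rep_space R. rep R 0 v = v \<and> (\<forall>a b. rep R (a + b) v = rep R a (rep R b v)) \<and>
        continuous_on UNIV (\<lambda>a. rep R a v))"

definition unitary_representation ::
  "('g::euclidean_space, 'm::{t2_space,topological_group_add}) supergroup
     \<Rightarrow> ('g, 'm) representation \<Rightarrow> bool" where
  "unitary_representation \<G> R \<longleftrightarrow>
     graded_hilbert_space R \<and> graded_unitary_group_rep R \<and>
     (\<forall>X. complex_linear_on (smooth_vectors \<G> R) (drep R X) \<and>
        drep R X ` smooth_vectors \<G> R \<subseteq> smooth_vectors \<G> R) \<and>
     (\<forall>v\<in>smooth_vectors \<G> R. linear (\<lambda>X. drep R X v)) \<and>
     (\<forall>i j. \<forall>X\<in>part \<G> i. \<forall>v\<in>smooth_vectors \<G> R \<inter> hilb R j. drep R X v \<in> hilb R (i + j)) \<and>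
     (\<forall>X\<in>part \<G> 0. \<forall>\<gamma>. one_parameter_group \<G> X \<gamma> \<longrightarrow>
        (\<forall>v\<in>smooth_vectors \<G> R.
           ((\<lambda>t. rep R (\<gamma> t) v) has_vector_derivative drep R X v) (at 0))) \<and>
     (\<forall>X\<in>part \<G> 1. \<forall>Y\<in>part \<G> 1. \<forall>v\<in>smooth_vectors \<G> R.
        drep R X (drep R Y v) + drep R Y (drep R X v) = scaleC (- \<i>) (drep R (brac \<G> X Y) v)) \<and>
     (\<forall>X\<in>part \<G> 1. \<forall>v\<in>smooth_vectors \<G> R. \<forall>w\<in>smooth_vectors \<G> R.
        cinner (drep R X v) w = cinner v (drep R X w)) \<and>
     (\<forall>a X. \<forall>v\<in>smooth_vectors \<G> R.
        drep R (Ad \<G> a X) v = rep R a (drep R X (rep R (- a) v)))"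

definition star_reduced ::
  "('g::euclidean_space, 'm::{t2_space,topological_group_add}) supergroup \<Rightarrow> bool" where
  "star_reduced \<G> \<longleftrightarrow>
     (\<forall>X. X \<noteq> 0 \<longrightarrow>
        (\<exists>R. unitary_representation \<G> R \<and> (\<exists>v\<in>smooth_vectors \<G> R. drep R X v \<noteq> 0)))"

end

(* For Z = X + iY with X, Y odd, the bracket of Z with its conjugate is [X, X] + [Y, Y], on which mu is
   nonnegative. Since mu is interior to the dual cone, it is strictly positive on each nonzero [X, X].
   Finally, [X, X] = 0 with X odd forces rho(X)^2 = 0 in every unitary representation, so rho(X) = 0
   by symmetry of rho(X), and X = 0 because the supergroup is star-reduced. *)

theory Submission
  imports Defs
begin

text \<open>Keeps the perturbations \<open>\<mu> + c * l\<close> inside the dual space, the ambient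
  space in which the interior of the dual cone is taken.\<close>

lemma dual_space_add_scaled:
  assumes "subspace V" "l \<in> dual_space V" "l' \<in> dual_space V"
  shows "(\<lambda>x. l x + c * l' x) \<in> dual_space V"
  using assms by (auto simp: dual_space_def algebra_simps)

text \<open>An interior functional stays in the dual cone after a small push in any direction of the
  dual space. A push that lowers the value at \<open>x\<close> would leave the cone if
  \<open>\<mu> x\<close> were 0.\<close>

lemma interior_dual_cone_pos:
  fixes V :: "'g::euclidean_space set"
  assumes V: "subspace V" and x: "x \<in> C" "x \<in> V" "x \<noteq> 0"
    and \<mu>: "\<mu> \<in> top_of_set (dual_space V) interior_of dual_cone V C"
  shows "0 < \<mu> x"
proof -
  from \<mu> obtain U where U: "open U" "\<mu> \<in> U" "dual_space V \<inter> U \<subseteq> dual_cone V C"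
    by (auto simp: interior_of_def openin_open)
  have "\<mu> \<in> dual_space V"
    using \<mu> interior_of_subset by (fastforce simp: dual_cone_def)
  \<comment> \<open>This direction is strictly negative at \<open>x\<close>, namely
    \<open>- (x \<bullet> x)\<close>; the value 0 off \<open>V\<close> is the convention of
    \<open>dual_space\<close>.\<close>
  define l where "l = (\<lambda>y. if y \<in> V then - (y \<bullet> x) else 0)"
  have l: "l \<in> dual_space V"
    using V by (auto simp: l_def dual_space_def inner_add_left subspace_add subspace_scale)
  define p where "p = (\<lambda>c y. \<mu> y + c * l y)"
  \<comment> \<open>The topology on functionals is pointwise convergence, so it suffices that each
    value is affine in \<open>c\<close>.\<close>
  have "continuous_on UNIV p"
    unfolding p_def by (intro continuous_on_coordinatewise_then_product continuous_intros)
  then have "open (p -` U)"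
    using U(1) by (rule open_vimage[rotated])
  moreover have "0 \<in> p -` U"
    using U(2) by (simp add: p_def)
  ultimately obtain e where "e > 0" "\<forall>c. dist c 0 < e \<longrightarrow> c \<in> p -` U"
    unfolding open_dist by blast
  then have e: "e > 0" "\<And>c. \<bar>c\<bar> < e \<Longrightarrow> p c \<in> U"
    by (auto simp: dist_real_def)
  have "p (e / 2) \<in> dual_cone V C"
  proof -
    have "p (e / 2) \<in> dual_space V"
      unfolding p_def by (rule dual_space_add_scaled[OF V \<open>\<mu> \<in> dual_space V\<close> l])
    moreover have "p (e / 2) \<in> U"
      using e(1) by (intro e(2)) simp
    ultimately show ?thesis using U(3) by blast
  qed
  \<comment> \<open>Membership of the perturbed functional in the dual cone, evaluated at
    \<open>x\<close>.\<close>
  then have "0 \<le> \<mu> x - e / 2 * (x \<bullet> x)"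
    using x by (auto simp: dual_cone_def p_def l_def)
  moreover have "0 < e / 2 * (x \<bullet> x)"
    using e x by simp
  ultimately show ?thesis by linarith
qed

lemma cinner_zero_right: "cinner v 0 = 0"
  by (simp add: cinner_def)

text \<open>Definiteness is inherited from the real inner product, which is the real part of
  \<open>cinner\<close>.\<close>

lemma cinner_self_eq_zero: "cinner v v = 0 \<Longrightarrow> v = 0"
  using inner_eq_zero_iff[of v] by (simp add: inner_ell2_def)

lemma star_reduced_odd_square_zero:
  assumes "star_reduced \<G>" "X \<in> part \<G> 1" "brac \<G> X X = 0"
  shows "X = 0"
proof (rule ccontr)
  assume "X \<noteq> 0"
  with assms(1) obtain R v where R: "unitary_representation \<G> R"
    and v: "v \<in> smooth_vectors \<G> R" "drep R X v \<noteq> 0"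
    unfolding star_reduced_def by blast
  let ?w = "drep R X v"
  \<comment> \<open>Invariance of the smooth vectors allows a second application of
    \<open>drep R X\<close> and the use of symmetry on the pair \<open>v\<close>,
    \<open>?w\<close>.\<close>
  have w: "?w \<in> smooth_vectors \<G> R"
    using R v(1) unfolding unitary_representation_def by blast
  have "drep R X ?w + drep R X ?w = scaleC (- \<i>) (drep R (brac \<G> X X) v)"
    using R v(1) assms(2) unfolding unitary_representation_def by blast
  \<comment> \<open>Linearity in the superalgebra argument turns the vanishing bracket into a
    vanishing right-hand side.\<close>
  also have "linear (\<lambda>X. drep R X v)"
    using R v(1) unfolding unitary_representation_def by blast
  then have "drep R (brac \<G> X X) v = 0"
    using assms(3) linear_0[of "\<lambda>X. drep R X v"] by simp
  also have "scaleC (- \<i>) 0 = 0"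
    by (rule ell2_eqI) simp
  finally have "2 *\<^sub>R drep R X ?w = 0"
    by (simp only: scaleR_2)
  then have "drep R X ?w = 0" by simp
  \<comment> \<open>Symmetry moves one factor across, so the squared norm of \<open>?w\<close> is
    the pairing of \<open>v\<close> with the square of \<open>drep R X\<close> at
    \<open>v\<close>.\<close>
  moreover have "cinner ?w ?w = cinner v (drep R X ?w)"
    using R v(1) w assms(2) unfolding unitary_representation_def by blast
  ultimately show False
    using v(2) cinner_zero_right cinner_self_eq_zero by simp
qed

lemma brac_odd_odd:
  assumes "lie_superalgebra \<gg>" "X \<in> part \<gg> 1" "Y \<in> part \<gg> 1"
  shows "brac \<gg> X Y \<in> part \<gg> 0"
proof -
  have "brac \<gg> X Y \<in> part \<gg> (1 + 1)"
    using assms unfolding lie_superalgebra_def by blast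
  then show ?thesis by simp
qed

text \<open>The Koszul sign of two odd elements is -1, which turns super skew-symmetry into
  symmetry.\<close>

lemma brac_odd_commute:
  assumes "lie_superalgebra \<gg>" "X \<in> part \<gg> 1" "Y \<in> part \<gg> 1"
  shows "brac \<gg> X Y = brac \<gg> Y X"
proof -
  have "brac \<gg> X Y = - (koszul 1 1 *\<^sub>R brac \<gg> Y X)"
    using assms unfolding lie_superalgebra_def by blast
  then show ?thesis by (simp add: koszul_def)
qed

text \<open>Real and imaginary parts of the form, on which both the Hermitian property and
  positivity are read off. A member of \<open>dual_space\<close> is linear only on the even part, so
  the expansion relies on brackets of odd elements being even.\<close>

lemma functionalC_bracC_conjC:
  assumes "lie_superalgebra \<gg>" "\<mu> \<in> dual_space (part \<gg> 0)"
    and "X \<in> part \<gg> 1" "Y \<in> part \<gg> 1" "X' \<in> part \<gg> 1" "Y' \<in> part \<gg> 1"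
  shows "functionalC \<mu> (bracC \<gg> (X, Y) (conjC (X', Y'))) =
    Complex (\<mu> (brac \<gg> X X') + \<mu> (brac \<gg> Y Y')) (\<mu> (brac \<gg> Y X') - \<mu> (brac \<gg> X Y'))"
proof -
  have bil: "bilinear (brac \<gg>)" and sub: "subspace (part \<gg> 0)"
    using assms(1) by (auto simp: lie_superalgebra_def)
  note even = brac_odd_odd[OF assms(1)]
  have add: "\<mu> (A + B) = \<mu> A + \<mu> B" and scale: "\<mu> (c *\<^sub>R A) = c * \<mu> A"
    if "A \<in> part \<gg> 0" "B \<in> part \<gg> 0" for A B c
    using assms(2) that by (auto simp: dual_space_def)
  have diff: "\<mu> (A - B) = \<mu> A - \<mu> B" if "A \<in> part \<gg> 0" "B \<in> part \<gg> 0" for A B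
    using add[of A "(-1) *\<^sub>R B"] scale[of B B "-1"] that subspace_scale[OF sub, of B "-1"] by simp
  show ?thesis
    using assms(3-6) even
    by (simp add: functionalC_def bracC_def conjC_def bilinear_rneg[OF bil] add diff)
qed

text \<open>Linearity in the first argument comes from bilinearity of the bracket, Hermitian
  symmetry from its symmetry on odd elements.\<close>

lemma odd_hermitian_form:
  assumes L: "lie_superalgebra \<gg>" and \<mu>: "\<mu> \<in> dual_space (part \<gg> 0)"
  shows "hermitian_form_on (part \<gg> 1 \<times> part \<gg> 1) (\<lambda>X Y. functionalC \<mu> (bracC \<gg> X (conjC Y)))"
proof -
  let ?b = "\<lambda>X Y. \<mu> (brac \<gg> X Y)"
  have bil: "bilinear (brac \<gg>)" and sub: "subspace (part \<gg> 1)"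
    using L by (auto simp: lie_superalgebra_def)
  note even = brac_odd_odd[OF L]
  have add: "?b (A + A') B = ?b A B + ?b A' B"
    if "A \<in> part \<gg> 1" "A' \<in> part \<gg> 1" "B \<in> part \<gg> 1" for A A' B
    using \<mu> even[OF that(1,3)] even[OF that(2,3)] by (simp add: dual_space_def bilinear_ladd[OF bil])
  have scale: "?b (c *\<^sub>R A) B = c * ?b A B"
    if "A \<in> part \<gg> 1" "B \<in> part \<gg> 1" for A B c
    using \<mu> even[OF that] by (simp add: dual_space_def bilinear_lmul[OF bil])
  have diff: "?b (A - A') B = ?b A B - ?b A' B"
    if "A \<in> part \<gg> 1" "A' \<in> part \<gg> 1" "B \<in> part \<gg> 1" for A A' B
    using add[of A "(-1) *\<^sub>R A'" B] scale[of A' B "-1"] that subspace_scale[OF sub, of A' "-1"] by simp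
  note sub_simps = subspace_add[OF sub] subspace_diff[OF sub] subspace_scale[OF sub]
  note form = functionalC_bracC_conjC[OF L \<mu>]
  show ?thesis
    unfolding hermitian_form_on_def
  proof (intro conjI ballI allI)
    fix X Y
    assume "X \<in> part \<gg> 1 \<times> part \<gg> 1" "Y \<in> part \<gg> 1 \<times> part \<gg> 1"
    \<comment> \<open>Exchanging the arguments fixes the real part and flips the sign of the
      imaginary part, since odd brackets commute.\<close>
    then show "functionalC \<mu> (bracC \<gg> Y (conjC X)) = cnj (functionalC \<mu> (bracC \<gg> X (conjC Y)))"
      by (auto simp: form complex_eq_iff brac_odd_commute[OF L])
  qed (auto simp: cscale_def form sub_simps add scale diff complex_eq_iff algebra_simps)
qed

lemma hermitian_form_on_subset:
  "hermitian_form_on S B \<Longrightarrow> T \<subseteq> S \<Longrightarrow> hermitian_form_on T B"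
  unfolding hermitian_form_on_def by blast

lemma positive_definite_on_subset:
  "positive_definite_on S B \<Longrightarrow> T \<subseteq> S \<Longrightarrow> positive_definite_on T B"
  unfolding positive_definite_on_def by blast

lemma odd_form_positive_definite:
  assumes L: "lie_superalgebra \<G>" and red: "star_reduced \<G>"
    and int: "\<mu> \<in> top_of_set (dual_space (part \<G> 0)) interior_of dual_cone (part \<G> 0) (super_cone \<G>)"
  shows "positive_definite_on (part \<G> 1 \<times> part \<G> 1) (\<lambda>X Y. functionalC \<mu> (bracC \<G> X (conjC Y)))"
proof -
  have \<mu>: "\<mu> \<in> dual_space (part \<G> 0)"
    using int interior_of_subset by (fastforce simp: dual_cone_def)
  have sub: "subspace (part \<G> 0)"
    using L by (simp add: lie_superalgebra_def)
  \<comment> \<open>\<open>[X, X]\<close> is a generator of the cone, and star-reducedness makes it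
    nonzero.\<close>
  have pos: "0 < \<mu> (brac \<G> X X)" if X: "X \<in> part \<G> 1" "X \<noteq> 0" for X
  proof (rule interior_dual_cone_pos[OF sub _ _ _ int])
    show "brac \<G> X X \<in> super_cone \<G>"
      unfolding super_cone_def using X(1) by (intro hull_inc) blast
    show "brac \<G> X X \<in> part \<G> 0"
      using brac_odd_odd[OF L X(1) X(1)] .
    show "brac \<G> X X \<noteq> 0"
      using star_reduced_odd_square_zero[OF red] X by blast
  qed
  \<comment> \<open>One component of a nonzero pair may vanish; its term then contributes 0.\<close>
  have "brac \<G> 0 0 = 0"
    using L by (simp add: lie_superalgebra_def bilinear_lzero)
  moreover have "\<mu> 0 = 0"
    using \<mu> subspace_0[OF sub] by (force simp: dual_space_def)
  ultimately have nonneg: "0 \<le> \<mu> (brac \<G> X X)" if "X \<in> part \<G> 1" for X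
    using pos[OF that] by (cases "X = 0") auto
  show ?thesis
    unfolding positive_definite_on_def
  proof (intro ballI impI)
    fix Z assume Z: "Z \<in> part \<G> 1 \<times> part \<G> 1" "Z \<noteq> 0"
    obtain X Y where XY: "Z = (X, Y)" by force
    then have odd: "X \<in> part \<G> 1" "Y \<in> part \<G> 1" and nz: "X \<noteq> 0 \<or> Y \<noteq> 0"
      using Z by (auto simp: zero_prod_def)
    have "0 < \<mu> (brac \<G> X X) + \<mu> (brac \<G> Y Y)"
      using nz pos odd nonneg by (metis add_nonneg_pos add_pos_nonneg)
    then show "functionalC \<mu> (bracC \<G> Z (conjC Z)) \<in> \<real> \<and> 0 < Re (functionalC \<mu> (bracC \<G> Z (conjC Z)))"
      \<comment> \<open>The imaginary part is \<open>\<mu> [Y, X] - \<mu> [X, Y]\<close>, which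
        cancels by symmetry.\<close>
      using odd brac_odd_commute[OF L odd] by (simp add: XY functionalC_bracC_conjC[OF L \<mu>] complex_is_Real_iff)
  qed
qed

theorem proposition6p1p3:
  fixes \<G> :: "('g::euclidean_space, 'm::{t2_space,topological_group_add}) supergroup"
    and \<hh> :: "'g set" and \<mu> \<alpha> :: "'g \<Rightarrow> real"
  assumes "lie_supergroup \<G>" and "star_reduced \<G>"
    and "cartan_subalgebra \<G> \<hh>" and "compactly_embedded \<G> \<hh>"
    and "\<mu> \<in> top_of_set (dual_space (part \<G> 0)) interior_of dual_cone (part \<G> 0) (super_cone \<G>)"
    and "\<mu> \<in> cartan_pullback \<G> \<hh> ` dual_space \<hh>"
    and "\<alpha> \<in> roots \<G> \<hh>" and "\<alpha> \<noteq> (\<lambda>_. 0)"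
  shows "hermitian_form_on (odd_root_space \<G> \<hh> \<alpha>) (\<lambda>X Y. functionalC \<mu> (bracC \<G> X (conjC Y)))
    \<and> positive_definite_on (odd_root_space \<G> \<hh> \<alpha>) (\<lambda>X Y. functionalC \<mu> (bracC \<G> X (conjC Y)))"
proof -
  have L: "lie_superalgebra \<G>"
    using assms(1) by (simp add: lie_supergroup_def)
  have \<mu>: "\<mu> \<in> dual_space (part \<G> 0)"
    using assms(5) interior_of_subset by (fastforce simp: dual_cone_def)
  \<comment> \<open>Pairs in the root space have odd components, so both properties of the form are
    inherited by restriction.\<close>
  have "odd_root_space \<G> \<hh> \<alpha> \<subseteq> part \<G> 1 \<times> part \<G> 1"
    by (simp add: odd_root_space_def)
  then show ?thesis
    using hermitian_form_on_subset[OF odd_hermitian_form[OF L \<mu>]]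
      positive_definite_on_subset[OF odd_form_positive_definite[OF L assms(2,5)]] by blast
qed

end
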